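(* Let $A,B,A'$ and $B'$ be finite posets, and let $\mathcal{Y}=(Y_a)_{a\in A}$ be a Ladkani family of subsets of $B$ indexed by $A$. Let $\alpha:A\to A'$ and $\beta:B\to B'$ be isomorphisms of posets. For every $a'\in A'$, define $Y'_{a'}=\beta(Y_{\alpha^{-1}(a')})$, and set $\mathcal{Y}'=(Y'_{a'})_{a'\in A'}$. Then $\mathcal{Y}'$ is a Ladkani family of subsets of $B'$ indexed by $A'$. Moreover, there are isomorphisms of posets $$(A\sqcup B)^+_{\mathcal{Y}}\cong(A'\sqcup B')^+_{\mathcal{Y}'}\quad\text{and}\quad(A\sqcup B)^-_{\mathcal{Y}}\cong(A'\sqcup B')^-_{\mathcal{Y}'}.$$
   Context: Let $A,B$ be finite posets. For $b\in B$ put $[b,\bullet]_B=\{b'\in B: b\leq_B b'\}$ and $[\bullet,b]_B=\{b'\in B: b'\leq_B b\}$. A family $\mathcal{Y}=(Y_a)_{a\in A}$ of subsets of $B$ is called a Ladkani family if: (1) for every $a\in A$ and all distinct $y,y'\in Y_a$: $[y,\bullet]_B\cap[y',\bullet]_B=\emptyset$ and $[\bullet,y]_B\cap[\bullet,y']_B=\emptyset$; (2) for all $a\leq_A a'$ in $A$ there is a bijection $\varphi_{aa'}:Y_a\to Y_{a'}$ with $y\leq_B\varphi_{aa'}(y)$ for every $y\in Y_a$. For a Ladkani family, the positive poset $(A\sqcup B)^+_{\mathcal{Y}}$ and negative poset $(A\sqcup B)^-_{\mathcal{Y}}$ are the disjoint union $A\sqcup B$ with partial orders $\leq_+$, $\leq_-$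 respectively, both restricting to the given orders on $A$ and on $B$, and whose only relations between $a\in A$ and $b\in B$ are: $a\leq_+ b$ iff there is $y\in Y_a$ with $y\leq_B b$ (never $b\leq_+a$); $b\leq_- a$ iff there is $y\in Y_a$ with $b\leq_B y$ (never $a\leq_-b$). *)

theory Defs
  imports Main
begin

text \<open>
  A poset is a carrier set together with an order relation satisfying
  \<^const>\<open>partial_order_on\<close>; in particular the relation only relates elements of the carrier,
  so that for \<open>b \<in> B\<close> the set \<open>above rB b\<close> is $[b,\bullet]_B$ and \<open>under rB b\<close> is $[\bullet,b]_B$.
\<close>

text \<open>The library's isomorphism notion for relations is intended for well-orders and takes the
  carrier to be the field of the relation, hence the following version for posets.\<close>

definition poset_iso :: "'a set \<Rightarrow> 'a rel \<Rightarrow> 'b set \<Rightarrow> 'b rel \<Rightarrow> ('a \<Rightarrow> 'b) \<Rightarrow> bool" where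
  "poset_iso A rA B rB f \<longleftrightarrow>
     partial_order_on A rA \<and> partial_order_on B rB \<and> bij_betw f A B \<and>
     (\<forall>x\<in>A. \<forall>y\<in>A. (x, y) \<in> rA \<longleftrightarrow> (f x, f y) \<in> rB)"

definition poset_isomorphic :: "'a set \<Rightarrow> 'a rel \<Rightarrow> 'b set \<Rightarrow> 'b rel \<Rightarrow> bool" where
  "poset_isomorphic A rA B rB \<longleftrightarrow> (\<exists>f. poset_iso A rA B rB f)"

text \<open>Only the values of \<open>Y\<close> on \<open>A\<close> matter, here and in the two orders below.\<close>

definition ladkani_family ::
    "'a set \<Rightarrow> 'a rel \<Rightarrow> 'b set \<Rightarrow> 'b rel \<Rightarrow> ('a \<Rightarrow> 'b set) \<Rightarrow> bool" where
  "ladkani_family A rA B rB Y \<longleftrightarrow>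
     (\<forall>a\<in>A. Y a \<subseteq> B) \<and>
     (\<forall>a\<in>A. \<forall>y\<in>Y a. \<forall>y'\<in>Y a. y \<noteq> y' \<longrightarrow>
        above rB y \<inter> above rB y' = {} \<and> under rB y \<inter> under rB y' = {}) \<and>
     (\<forall>a\<in>A. \<forall>a'\<in>A. (a, a') \<in> rA \<longrightarrow>
        (\<exists>\<phi>. bij_betw \<phi> (Y a) (Y a') \<and> (\<forall>y\<in>Y a. (y, \<phi> y) \<in> rB)))"

text \<open>The relations $\leq_+$ and $\leq_-$ on \<open>A <+> B\<close>. That they are partial orders is not built in:
  transitivity relies on the bijections of a Ladkani family.\<close>

definition pos_order ::
    "'a set \<Rightarrow> 'a rel \<Rightarrow> 'b set \<Rightarrow> 'b rel \<Rightarrow> ('a \<Rightarrow> 'b set) \<Rightarrow> ('a + 'b) rel" where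
  "pos_order A rA B rB Y =
     {(Inl a, Inl a') | a a'. (a, a') \<in> rA} \<union>
     {(Inr b, Inr b') | b b'. (b, b') \<in> rB} \<union>
     {(Inl a, Inr b) | a b. a \<in> A \<and> b \<in> B \<and> (\<exists>y\<in>Y a. (y, b) \<in> rB)}"

definition neg_order ::
    "'a set \<Rightarrow> 'a rel \<Rightarrow> 'b set \<Rightarrow> 'b rel \<Rightarrow> ('a \<Rightarrow> 'b set) \<Rightarrow> ('a + 'b) rel" where
  "neg_order A rA B rB Y =
     {(Inl a, Inl a') | a a'. (a, a') \<in> rA} \<union>
     {(Inr b, Inr b') | b b'. (b, b') \<in> rB} \<union>
     {(Inr b, Inl a) | a b. a \<in> A \<and> b \<in> B \<and> (\<exists>y\<in>Y a. (b, y) \<in> rB)}"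

end

theory Submission
  imports Defs
begin

text \<open>
  The family on the primed side is the transport of the given one along \<open>\<alpha>\<close> and \<open>\<beta>\<close>: it
  satisfies \<open>Y' (\<alpha> a) = \<beta> ` Y a\<close> for all \<open>a \<in> A\<close>, and everything below uses it only in this form.
  An isomorphism \<open>\<beta>\<close> maps principal up-sets and down-sets to principal up-sets and down-sets, so
  disjointness is transported, and the bijections required between the sets of the new family are
  the old ones conjugated by \<open>\<beta>\<close> (\<open>ladkani_family_transport\<close>). The mixed relations of the
  positive poset are expressed by \<open>\<le>\<^sub>B\<close> and membership in \<open>Y a\<close> alone, so the map
  \<open>map_sum \<alpha> \<beta>\<close>, which acts as \<open>\<alpha>\<close> on \<open>A\<close> and as \<open>\<beta>\<close> on \<open>B\<close>, preserves and reflects them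
  (\<open>poset_iso_pos_order\<close>).

  An isomorphism of posets includes the claim that both relations are partial orders. The only
  delicate point is transitivity across the two summands (\<open>partial_order_pos_order\<close>): if
  \<open>a \<le> a'\<close> and \<open>y' \<le> b\<close> with \<open>y' \<in> Y a'\<close>, then surjectivity of the bijection \<open>Y a \<rightarrow> Y a'\<close>
  yields some \<open>y \<in> Y a\<close> below \<open>y'\<close>, hence below \<open>b\<close>.

  The negative poset needs no separate argument: reversing the orders on \<open>A\<close> and \<open>B\<close> turns a
  Ladkani family into a Ladkani family, and the negative order is the reverse of the positive order
  of the reversed data (\<open>neg_order_eq_converse_pos_order\<close>).
\<close>

lemma partial_order_onD:
  assumes "partial_order_on A r"
  shows "r \<subseteq> A \<times> A" "refl_on A r" "trans r" "antisym r"
  using assms by (auto simp: partial_order_on_def preorder_on_def)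

lemma poset_isoD:
  assumes "poset_iso A rA B rB f"
  shows "partial_order_on A rA" "partial_order_on B rB" "bij_betw f A B"
    and "\<And>x y. x \<in> A \<Longrightarrow> y \<in> A \<Longrightarrow> (f x, f y) \<in> rB \<longleftrightarrow> (x, y) \<in> rA"
  using assms by (auto simp: poset_iso_def)

lemma ladkani_familyD:
  assumes "ladkani_family A rA B rB Y"
  shows "\<And>a. a \<in> A \<Longrightarrow> Y a \<subseteq> B"
    and "\<And>a y y'. a \<in> A \<Longrightarrow> y \<in> Y a \<Longrightarrow> y' \<in> Y a \<Longrightarrow> y \<noteq> y' \<Longrightarrow>
      above rB y \<inter> above rB y' = {} \<and> under rB y \<inter> under rB y' = {}"
    and "\<And>a a'. a \<in> A \<Longrightarrow> a' \<in> A \<Longrightarrow> (a, a') \<in> rA \<Longrightarrow>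
      \<exists>\<phi>. bij_betw \<phi> (Y a) (Y a') \<and> (\<forall>y\<in>Y a. (y, \<phi> y) \<in> rB)"
  using assms unfolding ladkani_family_def by blast+

section \<open>Reversing the orders\<close>

text \<open>
  Condition (1) is symmetric under exchanging up-sets and down-sets; the bijections of condition (2)
  are replaced by their inverses.
\<close>

lemma ladkani_family_converse:
  assumes "ladkani_family A rA B rB Y"
  shows "ladkani_family A (rA\<inverse>) B (rB\<inverse>) Y"
proof -
  have "\<exists>\<phi>. bij_betw \<phi> (Y a) (Y a') \<and> (\<forall>y\<in>Y a. (y, \<phi> y) \<in> rB\<inverse>)"
    if a: "a \<in> A" "a' \<in> A" "(a, a') \<in> rA\<inverse>" for a a'
  proof -
    obtain \<phi> where \<phi>: "bij_betw \<phi> (Y a') (Y a)" "\<forall>y\<in>Y a'. (y, \<phi> y) \<in> rB"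
      using ladkani_familyD(3)[OF assms, of a' a] a by auto
    have "(y, inv_into (Y a') \<phi> y) \<in> rB\<inverse>" if "y \<in> Y a" for y
    proof -
      have "inv_into (Y a') \<phi> y \<in> Y a'" "\<phi> (inv_into (Y a') \<phi> y) = y"
        using that \<phi>(1) by (auto simp: bij_betw_def inv_into_into f_inv_into_f)
      then show ?thesis using \<phi>(2) by force
    qed
    with bij_betw_inv_into[OF \<phi>(1)] show ?thesis by blast
  qed
  moreover have "above (rB\<inverse>) y = under rB y" "under (rB\<inverse>) y = above rB y" for y
    by (auto simp: above_def under_def)
  ultimately show ?thesis
    using ladkani_familyD(1,2)[OF assms] unfolding ladkani_family_def by auto
qed

lemma poset_iso_converse:
  "poset_iso A rA B rB f \<Longrightarrow> poset_iso A (rA\<inverse>) B (rB\<inverse>) f"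
  by (auto simp: poset_iso_def)

lemma neg_order_eq_converse_pos_order:
  "neg_order A rA B rB Y = (pos_order A (rA\<inverse>) B (rB\<inverse>) Y)\<inverse>"
  by (auto simp: neg_order_def pos_order_def)

section \<open>The positive order\<close>

lemma pos_order_simps [simp]:
  "(Inl a, Inl a') \<in> pos_order A rA B rB Y \<longleftrightarrow> (a, a') \<in> rA"
  "(Inr b, Inr b') \<in> pos_order A rA B rB Y \<longleftrightarrow> (b, b') \<in> rB"
  "(Inl a, Inr b) \<in> pos_order A rA B rB Y \<longleftrightarrow> a \<in> A \<and> b \<in> B \<and> (\<exists>y\<in>Y a. (y, b) \<in> rB)"
  "(Inr b, Inl a) \<notin> pos_order A rA B rB Y"
  by (auto simp: pos_order_def)

text \<open>
  The mixed relation is closed under going up in \<open>B\<close> by transitivity of \<open>\<le>\<^sub>B\<close>, and under going down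
  in \<open>A\<close> by surjectivity of the bijections between the sets \<open>Y a\<close>. Antisymmetry is inherited from
  the summands because nothing in \<open>B\<close> lies below anything in \<open>A\<close>.
\<close>

lemma partial_order_pos_order:
  assumes A: "partial_order_on A rA" and B: "partial_order_on B rB"
    and Y: "ladkani_family A rA B rB Y"
  shows "partial_order_on (A <+> B) (pos_order A rA B rB Y)" (is "partial_order_on ?S ?r")
proof -
  note A = partial_order_onD[OF A] and B = partial_order_onD[OF B]
  have down: "\<exists>y\<in>Y a. (y, b) \<in> rB" if le: "(a, a') \<in> rA" and y': "y' \<in> Y a'" "(y', b) \<in> rB"
    for a a' y' b
  proof -
    obtain \<phi> where "bij_betw \<phi> (Y a) (Y a')" "\<forall>y\<in>Y a. (y, \<phi> y) \<in> rB"
      using ladkani_familyD(3)[OF Y, of a a'] le A(1) by blast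
    moreover from this have "y' \<in> \<phi> ` Y a" using y'(1) by (simp add: bij_betw_def)
    ultimately obtain y where "y \<in> Y a" "(y, y') \<in> rB" by blast
    with y'(2) B(3) show ?thesis by (blast dest: transD)
  qed
  have "?r \<subseteq> ?S \<times> ?S"
    using A(1) B(1) by (auto simp: pos_order_def)
  moreover have "refl_on ?S ?r"
    using A(2) B(2) by (auto simp: refl_on_def)
  moreover have "antisym ?r"
    using A(4) B(4) by (auto simp: antisym_def pos_order_def)
  moreover have "trans ?r"
  proof (rule transI)
    fix x y z assume *: "(x, y) \<in> ?r" "(y, z) \<in> ?r"
    then show "(x, z) \<in> ?r"
    proof (cases x; cases y; cases z)
      fix a a' b assume "x = Inl a" "y = Inl a'" "z = Inr b"
      with * show ?thesis using A(1) down by auto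
    next
      fix a b b' assume "x = Inl a" "y = Inr b" "z = Inr b'"
      with * show ?thesis using B(1) transD[OF B(3)] by fastforce
    qed (use transD[OF A(3)] transD[OF B(3)] in auto)
  qed
  ultimately show ?thesis
    by (simp add: partial_order_on_def preorder_on_def)
qed

section \<open>Transport along isomorphisms\<close>

lemma above_poset_iso:
  assumes "poset_iso B rB B' rB' \<beta>" "y \<in> B"
  shows "above rB' (\<beta> y) = \<beta> ` above rB y"
proof -
  note iso = poset_isoD[OF assms(1)]
  have sub: "rB \<subseteq> B \<times> B" "rB' \<subseteq> B' \<times> B'" and img: "\<beta> ` B = B'"
    using iso by (auto simp: bij_betw_def dest: partial_order_onD(1))
  show ?thesis
  proof (intro equalityI subsetI)
    fix z assume "z \<in> above rB' (\<beta> y)"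
    then have z: "(\<beta> y, z) \<in> rB'" by (simp add: above_def)
    then have "z \<in> \<beta> ` B" unfolding img using sub(2) by blast
    then obtain x where "x \<in> B" "z = \<beta> x" by blast
    with z iso(4) assms(2) show "z \<in> \<beta> ` above rB y" by (auto simp: above_def)
  qed (use sub iso(4) in \<open>auto simp: above_def\<close>)
qed

lemma under_poset_iso:
  assumes "poset_iso B rB B' rB' \<beta>" "y \<in> B"
  shows "under rB' (\<beta> y) = \<beta> ` under rB y"
  using above_poset_iso[OF poset_iso_converse[OF assms(1)] assms(2)]
  by (simp add: above_def under_def)

lemma ladkani_family_transport:
  assumes \<alpha>: "poset_iso A rA A' rA' \<alpha>" and \<beta>: "poset_iso B rB B' rB' \<beta>"
    and Y: "ladkani_family A rA B rB Y"
    and Y': "\<And>a. a \<in> A \<Longrightarrow> Y' (\<alpha> a) = \<beta> ` Y a"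
  shows "ladkani_family A' rA' B' rB' Y'"
proof -
  note i\<alpha> = poset_isoD[OF \<alpha>] and i\<beta> = poset_isoD[OF \<beta>]
  note Y_sub = ladkani_familyD(1)[OF Y]
  have A': "A' = \<alpha> ` A" and inj: "inj_on \<beta> B" and B': "\<beta> ` B = B'"
    using i\<alpha>(3) i\<beta>(3) by (auto simp: bij_betw_def)
  have "Y' (\<alpha> a) \<subseteq> B'" if "a \<in> A" for a
    using that Y_sub Y' B' by blast
  moreover have "above rB' z \<inter> above rB' z' = {} \<and> under rB' z \<inter> under rB' z' = {}"
    if a: "a \<in> A" and z: "z \<in> Y' (\<alpha> a)" "z' \<in> Y' (\<alpha> a)" "z \<noteq> z'" for a z z'
  proof -
    obtain y y' where y: "y \<in> Y a" "y' \<in> Y a" "y \<noteq> y'" "z = \<beta> y" "z' = \<beta> y'"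
      using z Y'[OF a] by auto
    have yB: "y \<in> B" "y' \<in> B" using y(1,2) Y_sub[OF a] by auto
    have sub: "above rB x \<subseteq> B" "under rB x \<subseteq> B" for x
      using partial_order_onD(1)[OF i\<beta>(1)] by (auto simp: above_def under_def)
    have "\<beta> ` above rB y \<inter> \<beta> ` above rB y' = \<beta> ` (above rB y \<inter> above rB y')"
      and "\<beta> ` under rB y \<inter> \<beta> ` under rB y' = \<beta> ` (under rB y \<inter> under rB y')"
      by (simp_all add: inj_on_image_Int[OF inj] sub)
    then show ?thesis
      using ladkani_familyD(2)[OF Y a y(1-3)] y(4,5)
        above_poset_iso[OF \<beta>] under_poset_iso[OF \<beta>] yB by simp
  qed
  moreover have "\<exists>\<psi>. bij_betw \<psi> (Y' (\<alpha> a)) (Y' (\<alpha> a')) \<and> (\<forall>z\<in>Y' (\<alpha> a). (z, \<psi> z) \<in> rB')"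
    if a: "a \<in> A" "a' \<in> A" and le: "(\<alpha> a, \<alpha> a') \<in> rA'" for a a'
  proof -
    have "(a, a') \<in> rA" using le i\<alpha>(4) a by blast
    then obtain \<phi> where \<phi>: "bij_betw \<phi> (Y a) (Y a')" "\<forall>y\<in>Y a. (y, \<phi> y) \<in> rB"
      using ladkani_familyD(3)[OF Y a] by blast
    define \<psi> where "\<psi> = \<beta> \<circ> \<phi> \<circ> inv_into B \<beta>"
    have \<psi>: "\<psi> (\<beta> y) = \<beta> (\<phi> y)" if "y \<in> Y a" for y
      using that Y_sub[OF a(1)] inj by (auto simp: \<psi>_def)
    have sub: "Y a \<subseteq> B" "Y a' \<subseteq> B" using Y_sub a by auto
    have im: "\<phi> ` Y a = Y a'" using \<phi>(1) by (simp add: bij_betw_def)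
    have "bij_betw (inv_into B \<beta>) (\<beta> ` Y a) (Y a)"
      using bij_betw_inv_into_subset[OF i\<beta>(3) sub(1) refl] .
    moreover have "bij_betw \<beta> (Y a') (\<beta> ` Y a')"
      using inj_on_subset[OF inj sub(2)] by (rule inj_on_imp_bij_betw)
    ultimately have "bij_betw \<psi> (Y' (\<alpha> a)) (Y' (\<alpha> a'))"
      unfolding \<psi>_def Y'[OF a(1)] Y'[OF a(2)] using \<phi>(1) by (blast intro: bij_betw_trans)
    moreover have "(z, \<psi> z) \<in> rB'" if z: "z \<in> Y' (\<alpha> a)" for z
    proof -
      obtain y where y: "y \<in> Y a" "z = \<beta> y" using z Y'[OF a(1)] by auto
      have "y \<in> B" "\<phi> y \<in> B" using y(1) sub im by auto
      moreover have "(y, \<phi> y) \<in> rB" using \<phi>(2) y(1) by blast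
      ultimately show ?thesis unfolding y(2) \<psi>[OF y(1)] by (simp only: i\<beta>(4))
    qed
    ultimately show ?thesis by blast
  qed
  ultimately show ?thesis unfolding ladkani_family_def A' by blast
qed

lemma bij_betw_map_sum:
  assumes "bij_betw f A A'" "bij_betw g B B'"
  shows "bij_betw (map_sum f g) (A <+> B) (A' <+> B')"
proof -
  have "inj_on f A" "inj_on g B"
    using assms by (simp_all add: bij_betw_def)
  then have "inj_on (map_sum f g) (A <+> B)"
    by (intro inj_onI) (auto dest: inj_onD)
  moreover have "map_sum f g ` (A <+> B) = f ` A <+> g ` B"
    by (simp add: Plus_def image_Un image_image)
  ultimately show ?thesis
    using assms by (simp add: bij_betw_def)
qed

lemma poset_iso_pos_order:
  assumes \<alpha>: "poset_iso A rA A' rA' \<alpha>" and \<beta>: "poset_iso B rB B' rB' \<beta>"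
    and Y: "ladkani_family A rA B rB Y"
    and Y': "\<And>a. a \<in> A \<Longrightarrow> Y' (\<alpha> a) = \<beta> ` Y a"
  shows "poset_iso (A <+> B) (pos_order A rA B rB Y)
           (A' <+> B') (pos_order A' rA' B' rB' Y') (map_sum \<alpha> \<beta>)"
proof -
  note i\<alpha> = poset_isoD[OF \<alpha>] and i\<beta> = poset_isoD[OF \<beta>]
  have mem: "\<alpha> a \<in> A'" "\<beta> b \<in> B'" if "a \<in> A" "b \<in> B" for a b
    using that i\<alpha>(3) i\<beta>(3) by (auto simp: bij_betw_def)
  have mixed: "(\<exists>z\<in>Y' (\<alpha> a). (z, \<beta> b) \<in> rB') \<longleftrightarrow> (\<exists>y\<in>Y a. (y, b) \<in> rB)"
    if "a \<in> A" "b \<in> B" for a b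
    using that ladkani_familyD(1)[OF Y that(1)] i\<beta>(4) by (auto simp: Y')
  have "(x, y) \<in> pos_order A rA B rB Y \<longleftrightarrow>
      (map_sum \<alpha> \<beta> x, map_sum \<alpha> \<beta> y) \<in> pos_order A' rA' B' rB' Y'"
    if "x \<in> A <+> B" "y \<in> A <+> B" for x y
    using that i\<alpha>(4) i\<beta>(4) by (auto simp: mem mixed)
  then show ?thesis
    unfolding poset_iso_def
    using partial_order_pos_order[OF i\<alpha>(1) i\<beta>(1) Y]
      partial_order_pos_order[OF i\<alpha>(2) i\<beta>(2) ladkani_family_transport[OF \<alpha> \<beta> Y Y']]
      bij_betw_map_sum[OF i\<alpha>(3) i\<beta>(3)]
    by blast
qed

lemma poset_iso_neg_order:
  assumes "poset_iso A rA A' rA' \<alpha>" "poset_iso B rB B' rB' \<beta>"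
    and "ladkani_family A rA B rB Y"
    and "\<And>a. a \<in> A \<Longrightarrow> Y' (\<alpha> a) = \<beta> ` Y a"
  shows "poset_iso (A <+> B) (neg_order A rA B rB Y)
           (A' <+> B') (neg_order A' rA' B' rB' Y') (map_sum \<alpha> \<beta>)"
  unfolding neg_order_eq_converse_pos_order
  by (rule poset_iso_converse[OF poset_iso_pos_order[OF poset_iso_converse[OF assms(1)]
        poset_iso_converse[OF assms(2)] ladkani_family_converse[OF assms(3)] assms(4)]])

theorem proposition3p14:
  fixes A :: "'a set" and rA :: "'a rel"
    and B :: "'b set" and rB :: "'b rel"
    and A' :: "'c set" and rA' :: "'c rel"
    and B' :: "'d set" and rB' :: "'d rel"
    and Y :: "'a \<Rightarrow> 'b set" and Y' :: "'c \<Rightarrow> 'd set"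
    and \<alpha> :: "'a \<Rightarrow> 'c" and \<beta> :: "'b \<Rightarrow> 'd"
  assumes "finite A" and "partial_order_on A rA"
    and "finite B" and "partial_order_on B rB"
    and "finite A'" and "partial_order_on A' rA'"
    and "finite B'" and "partial_order_on B' rB'"
    and "ladkani_family A rA B rB Y"
    and "poset_iso A rA A' rA' \<alpha>"
    and "poset_iso B rB B' rB' \<beta>"
    and "\<And>a'. a' \<in> A' \<Longrightarrow> Y' a' = \<beta> ` Y (inv_into A \<alpha> a')"
  shows "ladkani_family A' rA' B' rB' Y' \<and>
    poset_isomorphic (A <+> B) (pos_order A rA B rB Y)
                     (A' <+> B') (pos_order A' rA' B' rB' Y') \<and>
    poset_isomorphic (A <+> B) (neg_order A rA B rB Y)
                     (A' <+> B') (neg_order A' rA' B' rB' Y')"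
proof -
  have inj: "inj_on \<alpha> A" and img: "\<alpha> ` A = A'"
    using poset_isoD(3)[OF assms(10)] by (auto simp: bij_betw_def)
  have "Y' (\<alpha> a) = \<beta> ` Y a" if "a \<in> A" for a
    using that assms(12)[of "\<alpha> a"] inj img by auto
  note transport = assms(10,11,9) this
  from ladkani_family_transport[OF transport] poset_iso_pos_order[OF transport]
    poset_iso_neg_order[OF transport]
  show ?thesis unfolding poset_isomorphic_def by blast
qed

end
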